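(* Let $W\subset S^1$ with $|W|=5$. Then $P(W)$ holds unless $W\cong\{0,\tfrac15,\tfrac25,\tfrac35,\tfrac45\}$ (the vertex set of a regular pentagon).
   Context: Identify $S^1$ with $\mathbb{R}/\mathbb{Z}$. The group $O(2)$ acts on $S^1$ by translations $x\mapsto x+a$ and reflections $x\mapsto -x+2a$. A coloring $c:S^1\to\{R,B\}$ is distinguishing if no non-identity $\gamma\in O(2)$ satisfies $c\circ\gamma=c$. For $W\subset S^1$ with trivial pointwise stabilizer in $O(2)$, $P(W)$ holds if every precoloring $c:S^1\setminus W\to\{R,B\}$ extends to a distinguishing coloring of $S^1$. Write $W\cong W'$ if $W'=\gamma(W)$ for some $\gamma\in O(2)$. *)

theory Defs
  imports Complex_Main
begin

text \<open>The circle S^1 = R/Z, represented by the canonical representatives in [0,1).\<close>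

typedef circle = "{x::real. 0 \<le> x \<and> x < 1}"
  by (rule exI[of _ 0]) simp

definition pt :: "real \<Rightarrow> circle" where
  "pt x = Abs_circle (frac x)"

definition rot :: "real \<Rightarrow> circle \<Rightarrow> circle" where
  "rot a p = pt (Rep_circle p + a)"

definition refl :: "real \<Rightarrow> circle \<Rightarrow> circle" where
  "refl a p = pt (- Rep_circle p + 2 * a)"

definition O2 :: "(circle \<Rightarrow> circle) set" where
  "O2 = range rot \<union> range refl"

text \<open>Colorings c : S^1 -> {R,B}, with R = True, B = False.\<close>
definition distinguishing :: "(circle \<Rightarrow> bool) \<Rightarrow> bool" where
  "distinguishing c \<longleftrightarrow> (\<forall>\<gamma>\<in>O2. \<gamma> \<noteq> id \<longrightarrow> c \<circ> \<gamma> \<noteq> c)"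

definition trivial_pointwise_stabilizer :: "circle set \<Rightarrow> bool" where
  "trivial_pointwise_stabilizer W \<longleftrightarrow> (\<forall>\<gamma>\<in>O2. (\<forall>w\<in>W. \<gamma> w = w) \<longrightarrow> \<gamma> = id)"

definition propP :: "circle set \<Rightarrow> bool" where
  "propP W \<longleftrightarrow> trivial_pointwise_stabilizer W \<and>
     (\<forall>c :: circle \<Rightarrow> bool. \<exists>c'. (\<forall>x. x \<notin> W \<longrightarrow> c' x = c x) \<and> distinguishing c')"

definition O2_congruent :: "circle set \<Rightarrow> circle set \<Rightarrow> bool" where
  "O2_congruent W W' \<longleftrightarrow> (\<exists>\<gamma>\<in>O2. W' = \<gamma> ` W)"

definition pentagon :: "circle set" where
  "pentagon = pt ` {0, 1/5, 2/5, 3/5, 4/5}"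

end

theory Submission
  imports Defs "HOL-Library.Groups_Big_Fun"
begin

text \<open>
  A reflection \<open>x \<mapsto> b - x\<close> exchanges the two orientations of a triangle, so a finite set with a
  reflection symmetry contains as many translates of a scalene triangle \<open>{p, q, r}\<close> as of its mirror
  image. Summing this excess with signs over the eight ways to color \<open>p\<close>, \<open>q\<close>, \<open>r\<close> isolates the
  translates lying exactly on \<open>{p, q, r}\<close>, of which there is one in the first orientation and none in
  the second. Hence not all eight colorings can have reflections.

  For infinite color classes only differences of the excess between almost equal colorings make
  sense, and these are governed by a homomorphism (the drift) on the group of translations that
  almost preserve the coloring. If the drift does not vanish at some \<open>t\<close>, then the coloring jumps
  between the two ends of finitely many \<open>t\<close>-orbits; weighting the coloring by these jumps gives a
  second odd density, linear in the coloring, and a combination of both has no drift.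

  Translation symmetries need no separate treatment: if a coloring and its recoloring at one
  point both have symmetries, then the coloring has a reflection symmetry. Finally, five points of
  the circle without a scalene triple form a regular pentagon.
\<close>

subsection \<open>Almost periods and drift\<close>

definition zmul :: "int \<Rightarrow> 'a::ab_group_add \<Rightarrow> 'a" where
  "zmul k a = (if 0 \<le> k then ((+) a ^^ nat k) 0 else - (((+) a ^^ nat (- k)) 0))"

lemma zmul_0 [simp]: "zmul 0 a = 0"
  by (simp add: zmul_def)

lemma zmul_1 [simp]: "zmul 1 a = a"
  by (simp add: zmul_def)

lemma zmul_plus_one: "zmul (k + 1) a = zmul k a + a"
proof -
  consider "0 \<le> k" | "k = -1" | "k < -1" by linarith
  then show ?thesis
  proof cases
    case 1
    then have "nat (k + 1) = Suc (nat k)" by simp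
    with 1 show ?thesis by (simp add: zmul_def add.commute)
  next
    case 2
    then show ?thesis by (simp add: zmul_def)
  next
    case 3
    then have "nat (- k) = Suc (nat (- (k + 1)))" by simp
    with 3 show ?thesis by (simp add: zmul_def)
  qed
qed

lemma zmul_add: "zmul (m + n) a = zmul m a + zmul n a"
proof (induction n rule: int_induct[where k = 0])
  case (step1 i)
  then show ?case using zmul_plus_one[of "m + i" a] zmul_plus_one[of i a]
    by (simp add: add.assoc)
next
  case (step2 i)
  then show ?case using zmul_plus_one[of "m + (i - 1)" a] zmul_plus_one[of "i - 1" a]
    by (simp add: algebra_simps)
qed simp

lemma zmul_minus: "zmul (- n) a = - zmul n a"
  using zmul_add[of n "- n" a] by (simp add: minus_unique)

lemma zmul_diff: "zmul (m - n) a = zmul m a - zmul n a"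
  using zmul_add[of m "- n" a] by (simp add: zmul_minus)

section \<open>Finitely supported integer functions and their sums\<close>

definition finsupp :: "('b \<Rightarrow> int) \<Rightarrow> bool" where
  "finsupp F \<longleftrightarrow> finite {x. F x \<noteq> 0}"

lemma finsuppI: "finite A \<Longrightarrow> (\<And>x. F x \<noteq> 0 \<Longrightarrow> x \<in> A) \<Longrightarrow> finsupp F"
  unfolding finsupp_def by (rule finite_subset[of _ A]) auto

lemma finsupp_zero [simp]: "finsupp (\<lambda>x. 0)"
  by (simp add: finsupp_def)

lemma finsupp_add: "finsupp F \<Longrightarrow> finsupp G \<Longrightarrow> finsupp (\<lambda>x. F x + G x)"
  by (rule finsuppI[of "{x. F x \<noteq> 0} \<union> {x. G x \<noteq> 0}"]) (auto simp: finsupp_def)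

lemma finsupp_minus: "finsupp F \<Longrightarrow> finsupp (\<lambda>x. - F x)"
  by (simp add: finsupp_def)

lemma finsupp_diff: "finsupp F \<Longrightarrow> finsupp G \<Longrightarrow> finsupp (\<lambda>x. F x - G x)"
  by (rule finsuppI[of "{x. F x \<noteq> 0} \<union> {x. G x \<noteq> 0}"]) (auto simp: finsupp_def)

lemma finsupp_mult: "finsupp F \<Longrightarrow> finsupp (\<lambda>x. g x * F x)"
  unfolding finsupp_def by (erule rev_finite_subset) auto

lemma finsupp_comp_inj: "finsupp F \<Longrightarrow> inj g \<Longrightarrow> finsupp (\<lambda>x. F (g x))"
  using finite_vimageI[of "{x. F x \<noteq> 0}" g] by (simp add: finsupp_def vimage_def)

lemma finsupp_shift: "finsupp F \<Longrightarrow> finsupp (\<lambda>x. F (x + a))" for a :: "'a::ab_group_add"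
  by (rule finsupp_comp_inj) (auto simp: inj_def)

lemma finsupp_reflect: "finsupp F \<Longrightarrow> finsupp (\<lambda>x. F (b - x))" for b :: "'a::ab_group_add"
  by (rule finsupp_comp_inj) (auto simp: inj_def)

text \<open>\<open>Sum_any\<close> takes the default value 0 on infinite support, so splitting a sum
  calls for finite support of both summands.\<close>

lemma Sum_any_add:
  "finsupp F \<Longrightarrow> finsupp G \<Longrightarrow> Sum_any (\<lambda>x. F x + G x) = Sum_any F + Sum_any G"
  by (rule Sum_any.distrib) (simp_all add: finsupp_def)

lemma Sum_any_minus: "Sum_any (\<lambda>x. - F x) = - Sum_any F" for F :: "'b \<Rightarrow> int"
  by (simp add: Sum_any.expand_set sum_negf)

lemma Sum_any_diff:
  "finsupp F \<Longrightarrow> finsupp G \<Longrightarrow> Sum_any (\<lambda>x. F x - G x) = Sum_any F - Sum_any G"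
  using Sum_any_add[of F "\<lambda>x. - G x"] by (simp add: finsupp_minus Sum_any_minus)

lemma Sum_any_cmult: "finsupp F \<Longrightarrow> Sum_any (\<lambda>x. k * F x) = k * Sum_any F"
  by (simp add: Sum_any_right_distrib finsupp_def)

lemma Sum_any_shift: "Sum_any (\<lambda>x. F (x + a)) = Sum_any F"
  for F :: "'a::ab_group_add \<Rightarrow> int"
  by (rule Sum_any.reindex_cong[symmetric, of "\<lambda>x. x + a"])
     (auto simp: fun_eq_iff intro!: bij_betw_byWitness[where f' = "\<lambda>x. x - a"])

lemma Sum_any_reflect: "Sum_any (\<lambda>x. F (b - x)) = Sum_any F"
  for F :: "'a::ab_group_add \<Rightarrow> int"
  by (rule Sum_any.reindex_cong[symmetric, of "\<lambda>x. b - x"])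
     (auto simp: fun_eq_iff intro!: bij_betw_byWitness[where f' = "\<lambda>x. b - x"])

text \<open>Formally the sum of a translate of \<open>F\<close> minus the sum of \<open>F\<close>.
  It sees only the behavior at infinity: the indicator of the nonnegative integers has drift
  \<open>a\<close> at \<open>a\<close>.\<close>

definition drift :: "('a::ab_group_add \<Rightarrow> int) \<Rightarrow> 'a \<Rightarrow> int" where
  "drift F a = Sum_any (\<lambda>x. F (x + a) - F x)"

definition almost_period :: "('a::ab_group_add \<Rightarrow> int) \<Rightarrow> 'a \<Rightarrow> bool" where
  "almost_period F a \<longleftrightarrow> finsupp (\<lambda>x. F (x + a) - F x)"

lemma almost_period_add:
  assumes "almost_period F a" "almost_period F b"
  shows "almost_period F (a + b)"
  using finsupp_add[OF finsupp_shift[OF assms(1)[unfolded almost_period_def], of b]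
      assms(2)[unfolded almost_period_def]]
  by (simp add: almost_period_def add.assoc add.commute[of b a])

text \<open>Telescope through \<open>x + b\<close>; the first difference is a translate of the one
  that defines \<open>drift F a\<close>.\<close>

lemma drift_add:
  assumes "almost_period F a" "almost_period F b"
  shows "drift F (a + b) = drift F a + drift F b"
proof -
  have a: "finsupp (\<lambda>x. F (x + a) - F x)" and b: "finsupp (\<lambda>x. F (x + b) - F x)"
    using assms by (auto simp: almost_period_def)
  have "drift F (a + b) = Sum_any (\<lambda>x. (F (x + b + a) - F (x + b)) + (F (x + b) - F x))"
    by (simp add: drift_def add.assoc add.commute[of b a])
  also have "\<dots> = Sum_any (\<lambda>x. F (x + b + a) - F (x + b)) + drift F b"
    using Sum_any_add[OF finsupp_shift[OF a, of b] b] by (simp add: drift_def)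
  also have "Sum_any (\<lambda>x. F (x + b + a) - F (x + b)) = drift F a"
    using Sum_any_shift[of "\<lambda>x. F (x + a) - F x" b] by (simp add: drift_def)
  finally show ?thesis .
qed

lemma almost_period_0 [simp]: "almost_period F 0"
  by (simp add: almost_period_def)

lemma drift_0 [simp]: "drift F 0 = 0"
  by (simp add: drift_def)

lemma almost_period_minus:
  assumes "almost_period F a"
  shows "almost_period F (- a)"
  using finsupp_minus[OF finsupp_shift[OF assms[unfolded almost_period_def], of "- a"]]
  by (simp add: almost_period_def)

lemma almost_period_diff:
  "almost_period F a \<Longrightarrow> almost_period F b \<Longrightarrow> almost_period F (a - b)"
  using almost_period_add[of F a "- b"] almost_period_minus[of F b] by simp

lemma almost_period_zmul:
  assumes "almost_period F a"
  shows "almost_period F (zmul n a)"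
proof (induction n rule: int_induct[where k = 0])
  case (step1 i)
  then show ?case using assms by (simp add: zmul_add almost_period_add)
next
  case (step2 i)
  then show ?case using assms by (simp add: zmul_diff almost_period_diff)
qed simp

lemma drift_zmul:
  assumes "almost_period F a"
  shows "drift F (zmul n a) = n * drift F a"
proof (induction n rule: int_induct[where k = 0])
  case (step1 i)
  then show ?case using assms
    by (simp add: zmul_add drift_add almost_period_zmul algebra_simps)
next
  case (step2 i)
  have "drift F (zmul (i - 1) a) + drift F a = drift F (zmul i a)"
    using drift_add[OF almost_period_zmul[OF assms, of "i - 1"] assms] by (simp add: zmul_diff)
  with step2 show ?case by (simp add: algebra_simps)
qed simp

text \<open>Reflecting the sum by \<open>b' - x\<close> turns \<open>G - F\<close> into a translate
  of \<open>F\<close> minus \<open>G\<close>. Adding both forms cancels \<open>G\<close> and leaves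
  a drift of \<open>F\<close>.\<close>

lemma Sum_any_diff_odd:
  fixes F G :: "'a::ab_group_add \<Rightarrow> int"
  assumes F: "\<And>x. F (b - x) = - F x" and G: "\<And>x. G (b' - x) = - G x"
    and fin: "finsupp (\<lambda>x. G x - F x)"
  shows "2 * Sum_any (\<lambda>x. G x - F x) = drift F (b - b')"
proof -
  have r: "G (b' - x) - F (b' - x) = F (x + (b - b')) - G x" for x
    using F[of "b' - x"] F[of "x + (b - b')"] G[of x] by (simp add: algebra_simps)
  have f: "finsupp (\<lambda>x. F (x + (b - b')) - G x)"
    using finsupp_reflect[OF fin, of b'] by (simp add: r)
  have "Sum_any (\<lambda>x. G x - F x) = Sum_any (\<lambda>x. F (x + (b - b')) - G x)"
    using Sum_any_reflect[of "\<lambda>x. G x - F x" b'] by (simp add: r)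
  then show ?thesis
    using Sum_any_add[OF f fin] by (simp add: drift_def)
qed

subsection \<open>Jumps along orbits\<close>

text \<open>If \<open>t\<close> is an almost period of infinite order, the sum telescopes to the
  value of \<open>f\<close> far ahead on the \<open>t\<close>-orbit of \<open>x\<close> minus the
  value far behind.\<close>

definition jump :: "('a::ab_group_add \<Rightarrow> int) \<Rightarrow> 'a \<Rightarrow> 'a \<Rightarrow> int" where
  "jump f t x = Sum_any (\<lambda>n. f (x + zmul (n + 1) t) - f (x + zmul n t))"

lemma inj_orbit: "inj (\<lambda>n. zmul n t) \<Longrightarrow> inj (\<lambda>n. x + zmul n t)"
  by (auto simp: inj_def)

lemma finsupp_jump:
  assumes "almost_period f t" "inj (\<lambda>n. zmul n t)"
  shows "finsupp (\<lambda>n. f (x + zmul (n + 1) t) - f (x + zmul n t))"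
  using finsupp_comp_inj[OF assms(1)[unfolded almost_period_def] inj_orbit[OF assms(2), of x]]
  by (simp add: zmul_add add.assoc)

lemma jump_finsupp:
  assumes "finsupp f" "inj (\<lambda>n. zmul n t)"
  shows "jump f t x = 0"
proof -
  have f: "finsupp (\<lambda>n. f (x + zmul n t))"
    using finsupp_comp_inj[OF assms(1) inj_orbit[OF assms(2), of x]] .
  show ?thesis unfolding jump_def
    using Sum_any_diff[OF finsupp_shift[OF f, of 1] f] Sum_any_shift[of "\<lambda>n. f (x + zmul n t)" 1]
    by simp
qed

text \<open>A finite change leaves the far ends of every orbit untouched.\<close>

lemma jump_cong_finsupp:
  assumes "almost_period f t" "inj (\<lambda>n. zmul n t)" "finsupp (\<lambda>x. g x - f x)"
  shows "jump g t x = jump f t x"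
proof -
  let ?h = "\<lambda>x. g x - f x"
  have h: "almost_period ?h t"
    using finsupp_diff[OF finsupp_shift[OF assms(3), of t] assms(3)] by (simp add: almost_period_def)
  have "jump g t x = jump f t x + jump ?h t x"
    unfolding jump_def
    using Sum_any_add[OF finsupp_jump[OF assms(1,2), of x] finsupp_jump[OF h assms(2), of x]]
    by simp
  then show ?thesis by (simp add: jump_finsupp assms(2,3))
qed

text \<open>The translate of \<open>f\<close> by an almost period is a finite change of
  \<open>f\<close>.\<close>

lemma jump_shift:
  assumes "almost_period f t" "inj (\<lambda>n. zmul n t)" "almost_period f a"
  shows "jump f t (x + a) = jump f t x"
  using jump_cong_finsupp[OF assms(1,2), of "\<lambda>x. f (x + a)" x] assms(3)
  by (simp add: almost_period_def jump_def add_ac)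

text \<open>A reflection exchanges the two ends of an orbit.\<close>

lemma jump_reflect:
  assumes "almost_period f t" "inj (\<lambda>n. zmul n t)" "finsupp (\<lambda>x. f (b - x) - f x)"
  shows "jump f t (b - x) = - jump f t x"
proof -
  let ?g = "\<lambda>n. f (b - x + zmul (n + 1) t) - f (b - x + zmul n t)"
  \<comment> \<open>The step from \<open>n\<close> to \<open>n + 1\<close> is reflected to the step
    between \<open>-1 - n\<close> and \<open>-n\<close>, hence the substitution.\<close>
  have "jump f t (b - x) = Sum_any (\<lambda>n. ?g (- 1 - n))"
    using Sum_any_reflect[of ?g "- 1"] by (simp add: jump_def)
  also have "\<dots> = Sum_any (\<lambda>n. - (f (b - (x + zmul (n + 1) t)) - f (b - (x + zmul n t))))"
    by (simp add: zmul_add zmul_diff zmul_minus algebra_simps)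
  also have "\<dots> = - jump (\<lambda>x. f (b - x)) t x"
    by (simp add: Sum_any_minus jump_def del: minus_diff_eq)
  finally show ?thesis
    using jump_cong_finsupp[OF assms(1,2,3)] by simp
qed

lemma jump_nonzero_hits:
  assumes "jump f t x \<noteq> 0"
  obtains n where "f (x + zmul n t + t) \<noteq> f (x + zmul n t)"
proof -
  obtain n where "f (x + zmul (n + 1) t) - f (x + zmul n t) \<noteq> 0"
    using assms unfolding jump_def by (rule Sum_any.not_neutral_obtains_not_neutral)
  then show thesis using that[of n] by (simp add: zmul_add add.assoc)
qed

text \<open>Translations by almost periods permute the finitely many orbits that carry a jump.\<close>
lemma almost_period_commensurable:
  fixes a :: "'a::ab_group_add"
  assumes t: "almost_period f t" "inj (\<lambda>n. zmul n t)" and a: "almost_period f a"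
    and x: "jump f t x \<noteq> 0"
  obtains m j where "m > 0" "zmul m a = zmul j t"
proof -
  let ?D = "{y. f (y + t) \<noteq> f y}"
  have D: "finite ?D" using t(1) by (simp add: almost_period_def finsupp_def)
  \<comment> \<open>The orbit of each \<open>x + i a\<close> carries the same nonzero jump, so it
    meets the finite set \<open>?D\<close>.\<close>
  have "\<exists>n. x + zmul (int i) a + zmul n t \<in> ?D" for i
  proof -
    have "jump f t (x + zmul (int i) a) \<noteq> 0"
      using x jump_shift[OF t almost_period_zmul[OF a]] by simp
    from jump_nonzero_hits[OF this] show ?thesis by blast
  qed
  then obtain n where n: "\<And>i. x + zmul (int i) a + zmul (n i) t \<in> ?D" by metis
  let ?g = "\<lambda>i. x + zmul (int i) a + zmul (n i) t"
  have "finite (range ?g)" using n finite_subset[OF _ D, of "range ?g"] by blast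
  \<comment> \<open>Pigeonhole: two of the infinitely many indices reach the same point of
    \<open>?D\<close>.\<close>
  then have "\<not> inj ?g" using finite_imageD[of ?g UNIV] by auto
  then obtain i i' where "i < i'" "?g i = ?g i'"
    unfolding inj_def by (metis linorder_neqE_nat)
  moreover have "zmul (int i' - int i) a = zmul (n i - n i') t"
    using \<open>?g i = ?g i'\<close> by (simp add: zmul_diff algebra_simps)
  ultimately show thesis using that[of "int i' - int i"] by simp
qed

text \<open>The drift of the jump-weighted function counts every orbit with the square of its jump.\<close>
lemma drift_jump_pos:
  fixes f :: "'a::ab_group_add \<Rightarrow> int"
  assumes t: "almost_period f t" "inj (\<lambda>n. zmul n t)" and x: "jump f t x \<noteq> 0"
  shows "drift (\<lambda>x. jump f t x * f x) t > 0"
proof -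
  let ?d = "\<lambda>y. f (y + t) - f y"
  let ?D = "{y. ?d y \<noteq> 0}"
  have D: "finite ?D" using t(1) by (simp add: almost_period_def finsupp_def)
  \<comment> \<open>The choice depends only on the orbit of \<open>y\<close>, so \<open>r\<close>
    selects one point of \<open>?D\<close> on each orbit that meets \<open>?D\<close>.\<close>
  define r where "r y = (SOME z. z \<in> ?D \<and> (\<exists>n. z = y + zmul n t))" for y
  have r: "r y \<in> ?D \<and> (\<exists>n. r y = y + zmul n t)" if "y + zmul m t \<in> ?D" for y m
    unfolding r_def by (rule someI_ex) (use that in blast)
  have r_orbit: "r (y + zmul m t) = r y" for y m
  proof -
    have "(\<exists>n. z = y + zmul m t + zmul n t) \<longleftrightarrow> (\<exists>n. z = y + zmul n t)" for z
    proof
      assume "\<exists>n. z = y + zmul m t + zmul n t"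
      then show "\<exists>n. z = y + zmul n t" by (metis zmul_add add.assoc)
    next
      assume "\<exists>n. z = y + zmul n t"
      then obtain n where "z = y + zmul n t" ..
      then have "z = y + zmul m t + zmul (n - m) t" by (simp add: zmul_diff)
      then show "\<exists>n. z = y + zmul m t + zmul n t" ..
    qed
    then show ?thesis by (simp add: r_def)
  qed
  have rD: "r y \<in> ?D" if "y \<in> ?D" for y using r[of y 0] that by simp
  have orbit: "jump f t (y + zmul n t) = jump f t y" for y n
    by (rule jump_shift[OF t almost_period_zmul[OF t(1)]])
  \<comment> \<open>The jump is constant on an orbit, and the differences of \<open>f\<close> along
    the orbit add up to that same jump: this gives the square.\<close>
  have fibre: "(\<Sum>y\<in>{y\<in>?D. r y = z}. jump f t y * ?d y) = jump f t z ^ 2"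
    if z: "z \<in> r ` ?D" for z
  proof -
    let ?N = "{n. ?d (z + zmul n t) \<noteq> 0}"
    obtain y0 n0 where y0: "y0 \<in> ?D" "z = r y0" "z = y0 + zmul n0 t" using z r[of _ 0] by force
    have rz: "r z = z" using r_orbit[of y0 n0] y0 by simp
    have eq: "{y\<in>?D. r y = z} = (\<lambda>n. z + zmul n t) ` ?N"
    proof (intro equalityI subsetI)
      fix y assume y: "y \<in> {y\<in>?D. r y = z}"
      then obtain n where "z = y + zmul n t" using r[of y 0] by auto
      then have "y = z + zmul (- n) t" by (simp add: zmul_minus)
      then show "y \<in> (\<lambda>n. z + zmul n t) ` ?N" using y by blast
    qed (use r_orbit rz in auto)
    have "(\<Sum>y\<in>{y\<in>?D. r y = z}. jump f t y * ?d y) = (\<Sum>n\<in>?N. jump f t z * ?d (z + zmul n t))"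
      unfolding eq
      by (subst sum.reindex) (auto simp: orbit intro: inj_on_subset[OF inj_orbit[OF t(2)]])
    also have "\<dots> = jump f t z * (\<Sum>n\<in>?N. ?d (z + zmul n t))"
      by (simp add: sum_distrib_left)
    also have "(\<Sum>n\<in>?N. ?d (z + zmul n t)) = jump f t z"
      by (simp add: jump_def Sum_any.expand_set zmul_add add.assoc)
    finally show ?thesis by (simp add: power2_eq_square)
  qed
  have "drift (\<lambda>x. jump f t x * f x) t = Sum_any (\<lambda>y. jump f t y * ?d y)"
    using jump_shift[OF t t(1)] by (simp add: drift_def right_diff_distrib)
  also have "\<dots> = (\<Sum>y\<in>?D. jump f t y * ?d y)"
    by (rule Sum_any.expand_superset[OF D]) auto
  also have "\<dots> = (\<Sum>z\<in>r ` ?D. \<Sum>y\<in>{y\<in>?D. r y = z}. jump f t y * ?d y)"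
    by (rule sum.image_gen[OF D])
  also have "\<dots> = (\<Sum>z\<in>r ` ?D. jump f t z ^ 2)"
    by (rule sum.cong) (use fibre in auto)
  also have "\<dots> > 0"
  proof -
    obtain n where n: "x + zmul n t \<in> ?D" using jump_nonzero_hits[OF x] by auto
    obtain k where k: "r x = x + zmul k t" using r[OF n] by blast
    have "r x \<in> r ` ?D" using r_orbit[of x n] n by (metis imageI)
    moreover have "jump f t (r x) ^ 2 > 0" using x k orbit by simp
    ultimately show ?thesis using D by (intro sum_pos2[of _ "r x"]) auto
  qed
  finally show ?thesis .
qed

text \<open>Replace \<open>f\<close> on each orbit by its common value at both ends. The result is
  \<open>t\<close>-invariant and differs from \<open>f\<close> only between points where
  \<open>f\<close> changes.\<close>

lemma jump_zero_imp_almost_invariant: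
  fixes f :: "'a::ab_group_add \<Rightarrow> int"
  assumes t: "almost_period f t" "inj (\<lambda>n. zmul n t)" and zero: "\<And>x. jump f t x = 0"
  obtains e where "\<And>x. e (x + t) = e x" "finsupp (\<lambda>x. f x - e x)"
proof -
  let ?d = "\<lambda>y. f (y + t) - f y"
  let ?D = "{y. ?d y \<noteq> 0}"
  have D: "finite ?D" using t(1) by (simp add: almost_period_def finsupp_def)
  \<comment> \<open>\<open>P x\<close> is the value at the forward end minus \<open>f x\<close>, and
    \<open>Q x\<close> is \<open>f x\<close> minus the value at the backward end;
    \<open>f + P\<close> is the invariant function sought.\<close>
  define P where "P x = Sum_any (\<lambda>n. if n \<ge> 0 then ?d (x + zmul n t) else 0)" for x
  define Q where "Q x = Sum_any (\<lambda>n. if n < 0 then ?d (x + zmul n t) else 0)" for x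
  have d: "finsupp (\<lambda>n. ?d (x + zmul n t))" for x
    using finsupp_jump[OF t, of x] by (simp add: zmul_add add.assoc)
  have dP: "finsupp (\<lambda>n. if R n then ?d (x + zmul n t) else 0)" for x R
    using d[of x] unfolding finsupp_def by (rule rev_finite_subset) auto
  have PQ: "P x + Q x = 0" for x
  proof -
    have "P x + Q x = Sum_any (\<lambda>n. ?d (x + zmul n t))"
      unfolding P_def Q_def by (subst Sum_any_add[symmetric, OF dP dP]) (rule Sum_any.cong, simp)
    then show ?thesis using zero[of x] by (simp add: jump_def zmul_add add.assoc)
  qed
  have Pt: "P x = P (x + t) + ?d x" for x
  proof -
    let ?G = "\<lambda>n. if n \<ge> 1 then ?d (x + zmul n t) else 0"
    have "P (x + t) = Sum_any (\<lambda>n. ?G (n + 1))"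
      unfolding P_def by (rule Sum_any.cong) (simp add: zmul_add add_ac)
    also have "\<dots> = Sum_any ?G" by (rule Sum_any_shift)
    finally have 1: "P (x + t) = Sum_any ?G" .
    have "P x = Sum_any (\<lambda>n. ?G n + (if n = 0 then ?d (x + zmul n t) else 0))"
      unfolding P_def by (rule Sum_any.cong) auto
    also have "\<dots> = Sum_any ?G + Sum_any (\<lambda>n. if n = 0 then ?d (x + zmul n t) else 0)"
      by (rule Sum_any_add[OF dP dP])
    finally show ?thesis using 1 by simp
  qed
  have "finsupp P"
  proof (rule finsuppI)
    \<comment> \<open>The number of steps from \<open>z\<close> to \<open>y\<close>. On different
      orbits the value is unspecified, but \<open>{0..m y z}\<close> is finite all the same.\<close>
    define m where "m y z = (THE n. z + zmul n t = y)" for y z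
    have m: "m (z + zmul n t) z = n" for z n
      unfolding m_def using t(2) by (intro the_equality) (auto dest: injD)
    let ?A = "\<Union>(y, z)\<in>?D \<times> ?D. (\<lambda>n. y - zmul n t) ` {0..m y z}"
    show "finite ?A" using D by auto
    fix x assume "P x \<noteq> 0"
    then obtain n where n: "n \<ge> 0" "x + zmul n t \<in> ?D"
      unfolding P_def by (rule Sum_any.not_neutral_obtains_not_neutral) (auto split: if_splits)
    \<comment> \<open>Since \<open>P x + Q x = 0\<close>, there is a change both ahead of
      \<open>x\<close> and behind it, so \<open>x\<close> lies between two points of
      \<open>?D\<close>.\<close>
    from \<open>P x \<noteq> 0\<close> have "Q x \<noteq> 0" using PQ[of x] by auto
    then obtain k where k: "k < 0" "x + zmul k t \<in> ?D"
      unfolding Q_def by (rule Sum_any.not_neutral_obtains_not_neutral) (auto split: if_splits)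
    have "m (x + zmul n t) (x + zmul k t) = n - k"
      using m[of "x + zmul k t" "n - k"] by (simp add: zmul_diff)
    then have "n \<in> {0..m (x + zmul n t) (x + zmul k t)}" using n k by simp
    moreover have "x = x + zmul n t - zmul n t" by simp
    ultimately have "x \<in> (\<lambda>i. x + zmul n t - zmul i t) ` {0..m (x + zmul n t) (x + zmul k t)}"
      by blast
    then show "x \<in> ?A" using n(2) k(2) by blast
  qed
  then show thesis
  proof (intro that[of "\<lambda>x. f x + P x"])
    show "f (x + t) + P (x + t) = f x + P x" for x using Pt[of x] by simp
  qed (simp add: finsupp_minus)
qed

subsection \<open>Chirality of colorings\<close>

text \<open>For an indicator \<open>f\<close>: does the triangle \<open>x, x + u, x + v\<close> lie
  in the color class, minus the same for its mirror image at \<open>x\<close>.\<close>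

definition chirality :: "'a::ab_group_add \<Rightarrow> 'a \<Rightarrow> ('a \<Rightarrow> int) \<Rightarrow> 'a \<Rightarrow> int" where
  "chirality u v f x = f x * f (x + u) * f (x + v) - f x * f (x - u) * f (x - v)"

lemma chirality_shift: "chirality u v (\<lambda>x. f (x + a)) x = chirality u v f (x + a)"
  by (simp add: chirality_def algebra_simps)

lemma chirality_reflect: "chirality u v (\<lambda>x. f (b - x)) x = - chirality u v f (b - x)"
  by (simp add: chirality_def algebra_simps)

lemma finsupp_chirality_diff:
  assumes "finsupp (\<lambda>x. f x - g x)"
  shows "finsupp (\<lambda>x. chirality u v f x - chirality u v g x)"
proof (rule finsuppI)
  \<comment> \<open>Chirality at \<open>x\<close> reads the coloring at five points only.\<close>
  let ?S = "\<lambda>a. {x. f (x + a) - g (x + a) \<noteq> 0}"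
  show "finite (?S 0 \<union> ?S u \<union> ?S v \<union> ?S (- u) \<union> ?S (- v))"
    by (intro finite_UnI finsupp_shift[OF assms, unfolded finsupp_def])
  show "x \<in> ?S 0 \<union> ?S u \<union> ?S v \<union> ?S (- u) \<union> ?S (- v)"
    if "chirality u v f x - chirality u v g x \<noteq> 0" for x
    using that by (auto simp: chirality_def)
qed

lemma almost_period_chirality:
  "almost_period f a \<Longrightarrow> almost_period (chirality u v f) a"
  using finsupp_chirality_diff[of "\<lambda>x. f (x + a)" f u v]
  by (simp add: almost_period_def chirality_shift)

lemma drift_cong_finsupp:
  assumes "almost_period F a" "finsupp (\<lambda>x. F x - G x)"
  shows "drift G a = drift F a"
proof -
  let ?h = "\<lambda>x. F x - G x"
  have h: "finsupp (\<lambda>x. ?h (x + a))" by (rule finsupp_shift[OF assms(2)])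
  have "drift G a = Sum_any (\<lambda>x. (F (x + a) - F x) - (?h (x + a) - ?h x))"
    by (simp add: drift_def)
  also have "\<dots> = drift F a - (Sum_any (\<lambda>x. ?h (x + a)) - Sum_any ?h)"
    unfolding drift_def
    using Sum_any_diff[OF assms(1)[unfolded almost_period_def] finsupp_diff[OF h assms(2)]]
      Sum_any_diff[OF h assms(2)] by simp
  finally show ?thesis using Sum_any_shift[of ?h a] by simp
qed

text \<open>For a polynomial that is affine in each of the three bits, this is the coefficient of
  their product.\<close>

definition third_difference :: "(bool \<Rightarrow> bool \<Rightarrow> bool \<Rightarrow> int) \<Rightarrow> int" where
  "third_difference g = g True True True - g True True False - g True False True
     - g False True True + g True False False + g False True False + g False False True
     - g False False False"

text \<open>The right-hand side is the permanent of the increments: each factor must supply a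
  different bit.\<close>

lemma third_difference_product:
  fixes a b c :: int
  shows "third_difference (\<lambda>i j k. (a + of_bool i * a1 + of_bool j * a2 + of_bool k * a3)
      * (b + of_bool i * b1 + of_bool j * b2 + of_bool k * b3)
      * (c + of_bool i * c1 + of_bool j * c2 + of_bool k * c3))
    = a1 * b2 * c3 + a1 * b3 * c2 + a2 * b1 * c3 + a2 * b3 * c1 + a3 * b1 * c2 + a3 * b2 * c1"
  unfolding third_difference_def of_bool_eq mult_1 mult_zero_left add_0_right by algebra

definition scalene :: "'a::ab_group_add \<Rightarrow> 'a \<Rightarrow> 'a \<Rightarrow> bool" where
  "scalene p q r \<longleftrightarrow> (\<forall>b. (\<lambda>x. b - x) ` {p, q, r} \<noteq> {p, q, r})"

text \<open>A triple with a repetition is preserved by the reflection that swaps its at most two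
  points.\<close>

lemma scalene_distinct:
  assumes "scalene p q r"
  shows "p \<noteq> q" "p \<noteq> r" "q \<noteq> r"
proof -
  show "p \<noteq> q" using assms[unfolded scalene_def, rule_format, of "p + r"] by auto
  show "p \<noteq> r" using assms[unfolded scalene_def, rule_format, of "p + q"] by auto
  show "q \<noteq> r" using assms[unfolded scalene_def, rule_format, of "p + r"] by auto
qed

definition extend3 :: "('a \<Rightarrow> bool) \<Rightarrow> 'a \<Rightarrow> 'a \<Rightarrow> 'a \<Rightarrow> bool \<Rightarrow> bool \<Rightarrow> bool \<Rightarrow> 'a \<Rightarrow> int" where
  "extend3 c p q r i j k x = of_bool ((c(p := i, q := j, r := k)) x)"

lemma extend3_affine:
  assumes "p \<noteq> q" "p \<noteq> r" "q \<noteq> r"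
  shows "extend3 c p q r i j k x = extend3 c p q r False False False x
     + of_bool i * of_bool (x = p) + of_bool j * of_bool (x = q) + of_bool k * of_bool (x = r)"
  using assms by (auto simp: extend3_def)

text \<open>The third difference over the colors of three points counts the copies of the triangle
  placed exactly on these points; only the first of the two orientations occurs.\<close>
lemma third_difference_chirality_pos:
  fixes p q r :: "'a::ab_group_add" and c :: "'a \<Rightarrow> bool"
  assumes "scalene p q r"
  defines "T \<equiv> \<lambda>x. third_difference (\<lambda>i j k. chirality (q - p) (r - p) (extend3 c p q r i j k) x)"
  shows "Sum_any T > 0"
proof -
  note d = scalene_distinct[OF assms(1)]
  let ?f = "extend3 c p q r"
  let ?base = "extend3 c p q r False False False"
  let ?\<delta> = "\<lambda>w x. of_bool (x = w) :: int"
  \<comment> \<open>The permanent of the incidence matrix of \<open>x, y, z\<close> with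
    \<open>p, q, r\<close>; nonzero only if the two triples agree as sets.\<close>
  define perm where "perm x y z = ?\<delta> p x * ?\<delta> q y * ?\<delta> r z + ?\<delta> p x * ?\<delta> r y * ?\<delta> q z
    + ?\<delta> q x * ?\<delta> p y * ?\<delta> r z + ?\<delta> q x * ?\<delta> r y * ?\<delta> p z
    + ?\<delta> r x * ?\<delta> p y * ?\<delta> q z + ?\<delta> r x * ?\<delta> q y * ?\<delta> p z" for x y z
  have prod: "third_difference (\<lambda>i j k. ?f i j k x * ?f i j k y * ?f i j k z) = perm x y z" for x y z
  proof -
    have "(\<lambda>i j k. ?f i j k x * ?f i j k y * ?f i j k z) = (\<lambda>i j k.
        (?base x + of_bool i * ?\<delta> p x + of_bool j * ?\<delta> q x + of_bool k * ?\<delta> r x)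
      * (?base y + of_bool i * ?\<delta> p y + of_bool j * ?\<delta> q y + of_bool k * ?\<delta> r y)
      * (?base z + of_bool i * ?\<delta> p z + of_bool j * ?\<delta> q z + of_bool k * ?\<delta> r z))"
      by (intro ext arg_cong2[where f = "(*)"] extend3_affine[OF d])
    then show ?thesis unfolding perm_def by (simp only: third_difference_product)
  qed
  have pos: "perm x y z \<ge> 0" for x y z
    by (simp add: perm_def)
  have supp: "{x, y, z} = {p, q, r}" if "perm x y z \<noteq> 0" for x y z
    using that by (auto simp: perm_def of_bool_def split: if_splits)
  \<comment> \<open>A mirror image placed on \<open>{p, q, r}\<close> would make
    \<open>x + p - y\<close> a reflection symmetry of the triple.\<close>
  have zero: "perm x (x - (q - p)) (x - (r - p)) = 0" for x
  proof (rule ccontr)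
    assume "perm x (x - (q - p)) (x - (r - p)) \<noteq> 0"
    then have "(\<lambda>y. x + p - y) ` {p, q, r} = {p, q, r}"
      using supp[of x "x - (q - p)" "x - (r - p)"] by (simp add: algebra_simps)
    then show False using assms(1) unfolding scalene_def by blast
  qed
  have "T x = perm x (x + (q - p)) (x + (r - p)) - perm x (x - (q - p)) (x - (r - p))" for x
    unfolding T_def prod[symmetric] by (simp add: third_difference_def chirality_def)
  then have T: "T x = perm x (x + (q - p)) (x + (r - p))" for x
    using zero by simp
  have "{x. T x \<noteq> 0} \<subseteq> {p, q, r}"
    using supp unfolding T by blast
  then have "Sum_any T = (\<Sum>x\<in>{p, q, r}. T x)"
    by (intro Sum_any.expand_superset) auto
  also have "\<dots> > 0"
  proof (rule sum_pos2[of _ p])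
    show "T p > 0" unfolding T using d by (simp add: perm_def)
  qed (use pos T in auto)
  finally show ?thesis .
qed

text \<open>The eight signs cancel, so the reference \<open>H\<close> may be subtracted from every
  term, which makes each sum finite.\<close>

lemma Sum_any_third_difference:
  assumes "\<And>i j k. finsupp (\<lambda>x. G i j k x - H x)" "\<And>i j k. Sum_any (\<lambda>x. G i j k x - H x) = 0"
  shows "Sum_any (\<lambda>x. third_difference (\<lambda>i j k. G i j k x)) = 0"
proof -
  let ?g = "\<lambda>i j k x. G i j k x - H x"
  have "Sum_any (\<lambda>x. third_difference (\<lambda>i j k. G i j k x))
    = Sum_any (\<lambda>x. ?g True True True x - ?g True True False x - ?g True False True x
     - ?g False True True x + ?g True False False x + ?g False True False x + ?g False False True x
     - ?g False False False x)"
    by (rule Sum_any.cong) (simp add: third_difference_def)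
  also have "\<dots> = 0"
    by (simp only: Sum_any_add Sum_any_diff finsupp_add finsupp_diff assms)
  finally show ?thesis .
qed

text \<open>Otherwise each of the eight colorings has a reflection \<open>B i j k - x\<close>. An
  odd density without drift then has third difference of sum 0, against
  \<open>third_difference_chirality_pos\<close>.\<close>

lemma scalene_extension_without_reflection:
  fixes p q r :: "'a::ab_group_add" and c :: "'a \<Rightarrow> bool"
  assumes scalene: "scalene p q r"
  shows "\<exists>i j k. \<forall>b. \<exists>x. (c(p := i, q := j, r := k)) (b - x) \<noteq> (c(p := i, q := j, r := k)) x"
proof (rule ccontr)
  assume "\<not> ?thesis"
  then obtain B where
    B: "\<And>i j k x. (c(p := i, q := j, r := k)) (B i j k - x) = (c(p := i, q := j, r := k)) x"
    by metis
  let ?f = "extend3 c p q r"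
  let ?base = "extend3 c p q r False False False"
  let ?ctr = "B False False False"
  let ?K = "chirality (q - p) (r - p)"
  have fB: "?f i j k (B i j k - x) = ?f i j k x" for i j k x
    using B[of i j k x] by (simp add: extend3_def)
  have fin: "finsupp (\<lambda>x. ?f i j k x - ?base x)" for i j k
    by (rule finsuppI[of "{p, q, r}"]) (auto simp: extend3_def split: if_splits)
  have finB: "finsupp (\<lambda>x. ?base (B i j k - x) - ?base x)" for i j k
    using finsupp_diff[OF fin[of i j k] finsupp_reflect[OF fin[of i j k], of "B i j k"]]
    by (simp add: fB)
  \<comment> \<open>Composing the exact reflection of \<open>?base\<close> with an almost reflection
    gives an almost period.\<close>
  have per: "almost_period ?base (?ctr - B i j k)" for i j k
  proof -
    have "?base (B i j k - x) = ?base (x + (?ctr - B i j k))" for x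
      using fB[of False False False "B i j k - x"] by (simp add: algebra_simps)
    then show ?thesis using finB[of i j k] by (simp add: almost_period_def)
  qed
  \<comment> \<open>Any odd weight \<open>\<omega>\<close> may be used to correct the chirality: its
    term is affine in the three bits, so the third difference removes it.\<close>
  have vanish: False if \<omega>: "\<And>i j k x. \<omega> (B i j k - x) = - \<omega> x"
    and \<alpha>: "\<alpha> \<noteq> 0"
    and drift: "\<And>i j k. drift (\<lambda>x. \<alpha> * ?K ?base x - \<beta> * (\<omega> x * ?base x)) (?ctr - B i j k) = 0"
    for \<omega> and \<alpha> \<beta> :: int
  proof -
    define M where "M f x = \<alpha> * ?K f x - \<beta> * (\<omega> x * f x)" for f x
    have odd: "M (?f i j k) (B i j k - x) = - M (?f i j k) x" for i j k x
      using chirality_reflect[of "q - p" "r - p" "?f i j k" "B i j k" x]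
      by (simp add: M_def fB \<omega>)
    have finM: "finsupp (\<lambda>x. M (?f i j k) x - M ?base x)" for i j k
    proof -
      have "finsupp (\<lambda>x. \<alpha> * (?K (?f i j k) x - ?K ?base x) - (\<beta> * \<omega> x) * (?f i j k x - ?base x))"
        by (intro finsupp_diff finsupp_mult finsupp_chirality_diff fin)
      then show ?thesis by (simp add: M_def algebra_simps)
    qed
    have "Sum_any (\<lambda>x. M (?f i j k) x - M ?base x) = 0" for i j k
      using Sum_any_diff_odd[of "M ?base" ?ctr "M (?f i j k)" "B i j k", OF odd odd finM]
        drift[of i j k] by (simp add: M_def[abs_def])
    then have "Sum_any (\<lambda>x. third_difference (\<lambda>i j k. M (?f i j k) x)) = 0"
      using finM by (rule Sum_any_third_difference[rotated])
    moreover have "third_difference (\<lambda>i j k. M (?f i j k) x)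
      = \<alpha> * third_difference (\<lambda>i j k. ?K (?f i j k) x)" for x
    proof -
      have "third_difference (\<lambda>i j k. M (?f i j k) x)
        = \<alpha> * third_difference (\<lambda>i j k. ?K (?f i j k) x)
          - \<beta> * \<omega> x * third_difference (\<lambda>i j k. ?f i j k x)"
        by (simp add: third_difference_def M_def algebra_simps)
      moreover have "third_difference (\<lambda>i j k. ?f i j k x) = 0"
      proof -
        have "third_difference (\<lambda>i j k. ?f i j k x) = third_difference (\<lambda>i j k. ?base x
          + of_bool i * of_bool (x = p) + of_bool j * of_bool (x = q) + of_bool k * of_bool (x = r))"
          by (intro arg_cong[where f = third_difference] ext
              extend3_affine[OF scalene_distinct[OF scalene]])
        then show ?thesis by (simp add: third_difference_def)
      qed
      ultimately show ?thesis by simp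
    qed
    \<comment> \<open>A positive \<open>Sum_any\<close> is not the default 0 of an infinite
      support.\<close>
    moreover have "finsupp (\<lambda>x. third_difference (\<lambda>i j k. ?K (?f i j k) x))"
      using third_difference_chirality_pos[OF scalene, of c] Sum_any.infinite
      unfolding finsupp_def by fastforce
    ultimately show False
      using \<alpha> third_difference_chirality_pos[OF scalene, of c] by (simp add: Sum_any_cmult)
  qed
  show False
  proof (cases "\<forall>i j k. drift (?K ?base) (?ctr - B i j k) = 0")
    case True
    then show False using vanish[of "\<lambda>x. 0" 1 0] by simp
  next
    case False
    then obtain i0 j0 k0 where d: "drift (?K ?base) (?ctr - B i0 j0 k0) \<noteq> 0" by blast
    define t where "t = ?ctr - B i0 j0 k0"
    have pt: "almost_period ?base t" using per by (simp add: t_def)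
    note Kt = almost_period_chirality[OF pt]
    \<comment> \<open>The drift at \<open>n t\<close> is \<open>n\<close> times the drift at
      \<open>t\<close>, so \<open>t\<close> has infinite order.\<close>
    have inj: "inj (\<lambda>n. zmul n t)"
    proof (rule injI)
      fix m n assume "zmul m t = zmul n t"
      then have "drift (?K ?base) (zmul (m - n) t) = 0" by (simp add: zmul_diff)
      then show "m = n" using d by (simp add: drift_zmul[OF Kt] t_def[symmetric])
    qed
    \<comment> \<open>Without jumps \<open>?base\<close> would be a finite change of a
      \<open>t\<close>-invariant function, whose chirality has no drift at \<open>t\<close>.\<close>
    have "\<exists>x. jump ?base t x \<noteq> 0"
    proof (rule ccontr)
      assume "\<not> ?thesis"
      then obtain e where e: "\<And>x. e (x + t) = e x" "finsupp (\<lambda>x. ?base x - e x)"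
        using jump_zero_imp_almost_invariant[OF pt inj] by blast
      have "drift (?K e) t = drift (?K ?base) t"
        by (rule drift_cong_finsupp[OF Kt finsupp_chirality_diff[OF e(2)]])
      moreover have "drift (?K e) t = 0"
        using chirality_shift[of "q - p" "r - p" e t] by (simp add: drift_def e(1))
      ultimately show False using d by (simp add: t_def)
    qed
    then obtain x0 where x0: "jump ?base t x0 \<noteq> 0" ..
    let ?\<omega> = "jump ?base t"
    let ?L = "\<lambda>x. ?\<omega> x * ?base x"
    \<comment> \<open>The coefficients are the two drifts, crossed so that they cancel at
      \<open>t\<close>.\<close>
    let ?\<alpha> = "drift ?L t"
    let ?\<beta> = "drift (?K ?base) t"
    let ?M = "\<lambda>x. ?\<alpha> * ?K ?base x - ?\<beta> * ?L x"
    have Lper: "finsupp (\<lambda>x. ?L (x + a) - ?L x)" if "almost_period ?base a" for a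
      using finsupp_mult[OF that[unfolded almost_period_def], of ?\<omega>] jump_shift[OF pt inj that]
      by (simp add: right_diff_distrib)
    have Kper: "finsupp (\<lambda>x. ?K ?base (x + a) - ?K ?base x)" if "almost_period ?base a" for a
      using almost_period_chirality[OF that] by (simp add: almost_period_def)
    have M_eq: "(\<lambda>x. ?M (x + a) - ?M x)
      = (\<lambda>x. ?\<alpha> * (?K ?base (x + a) - ?K ?base x) - ?\<beta> * (?L (x + a) - ?L x))" for a
      by (simp add: algebra_simps)
    have Mper: "almost_period ?M a" if "almost_period ?base a" for a
      unfolding almost_period_def M_eq
      by (intro finsupp_diff finsupp_mult Lper[OF that] Kper[OF that])
    have "drift ?M t = ?\<alpha> * ?\<beta> - ?\<beta> * ?\<alpha>"
      unfolding drift_def[of ?M] M_eq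
      using Sum_any_diff[OF finsupp_mult[OF Kper[OF pt], of "\<lambda>_. ?\<alpha>"]
          finsupp_mult[OF Lper[OF pt], of "\<lambda>_. ?\<beta>"]]
        Sum_any_cmult[OF Kper[OF pt], of ?\<alpha>] Sum_any_cmult[OF Lper[OF pt], of ?\<beta>]
      by (simp add: drift_def)
    then have Mt: "drift ?M t = 0" by simp
    \<comment> \<open>A positive multiple of each difference is a multiple of \<open>t\<close>, so
      vanishing at \<open>t\<close> suffices.\<close>
    have "drift ?M (?ctr - B i j k) = 0" for i j k
    proof -
      let ?a = "?ctr - B i j k"
      obtain m n where mn: "m > 0" "zmul m ?a = zmul n t"
        using almost_period_commensurable[OF pt inj per x0] .
      have "m * drift ?M ?a = n * drift ?M t"
        using drift_zmul[OF Mper[OF per], of m i j k] drift_zmul[OF Mper[OF pt], of n] mn(2) by simp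
      then show ?thesis using Mt mn(1) by simp
    qed
    then show False
      using vanish[of ?\<omega> ?\<alpha> ?\<beta>] jump_reflect[OF pt inj finB] drift_jump_pos[OF pt inj x0] by simp
  qed
qed

section \<open>From reflections to all symmetries\<close>

definition symmetric_coloring :: "('a::ab_group_add \<Rightarrow> bool) \<Rightarrow> bool" where
  "symmetric_coloring c \<longleftrightarrow>
     (\<exists>a. a \<noteq> 0 \<and> (\<forall>x. c (x + a) = c x)) \<or> (\<exists>b. \<forall>x. c (b - x) = c x)"

text \<open>A translation symmetry cannot survive recoloring one point, nor can it turn into a reflection
  that moves this point.\<close>
lemma reflection_if_recoloring_symmetric:
  fixes c :: "'a::ab_group_add \<Rightarrow> bool"
  assumes "symmetric_coloring c" "symmetric_coloring (c(w := \<not> c w))"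
  shows "\<exists>b. \<forall>x. c (b - x) = c x"
proof (rule ccontr)
  assume no: "\<not> ?thesis"
  let ?c = "c(w := \<not> c w)"
  obtain a where a: "a \<noteq> 0" "\<And>x. c (x + a) = c x"
    using assms(1) no by (auto simp: symmetric_coloring_def)
  have a': "c (w - a) = c w" using a(2)[of "w - a"] by simp
  from assms(2) consider (t) a' where "a' \<noteq> 0" "\<And>x. ?c (x + a') = ?c x"
    | (r) b where "\<And>x. ?c (b - x) = ?c x"
    unfolding symmetric_coloring_def by blast
  then show False
  proof cases
    case t
    have 1: "c (w + a') \<noteq> c w" using t(2)[of w] t(1) by simp
    \<comment> \<open>Compare the colors at \<open>w + a + a'\<close>, reached by both periods; the
      case \<open>a + a' = 0\<close>, where this point is \<open>w\<close>, is separate.\<close>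
    have 2: "c (w + a + a') = c (w + a')" using a(2)[of "w + a'"] by (simp add: add_ac)
    show False
    proof (cases "a + a' = 0")
      case True
      then have "w + a' = w - a" by (simp add: eq_neg_iff_add_eq_0 add.commute)
      then show False using 1 a' by simp
    next
      case False
      then have "c (w + a + a') = ?c (w + a + a')" by (simp add: add.assoc)
      also have "\<dots> = c (w + a)" using t(2)[of "w + a"] a(1) by simp
      finally show False using 1 2 a(2) by simp
    qed
  next
    case r
    show False
    proof (cases "b - w = w")
      case True
      have "c (b - x) = c x" for x
        using r[of x] True by (cases "x = w") (auto split: if_splits)
      then show False using no by blast
    next
      case False
      \<comment> \<open>The mirror image of \<open>w\<close>. Then \<open>z + a\<close> mirrors
        \<open>w - a\<close>, which has the old color of \<open>w\<close>, while the period
        \<open>a\<close> gives it the color of \<open>z\<close>.\<close>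
      define z where "z = b - w"
      have z: "c z \<noteq> c w" using r[of w] False by (simp add: z_def)
      have "c (z + a) \<noteq> c w" using z a(2) by simp
      moreover have "?c (z + a) = c w"
        using r[of "w - a"] a' a(1) by (simp add: z_def algebra_simps)
      moreover have "z + a \<noteq> w" using z a(2)[of z] by auto
      ultimately show False by simp
    qed
  qed
qed

text \<open>An extension without reflections may still have a period; then recoloring
  \<open>p\<close> removes all symmetries.\<close>

lemma scalene_extension_asymmetric:
  fixes W :: "'a::ab_group_add set"
  assumes "{p, q, r} \<subseteq> W" "scalene p q r"
  shows "\<exists>c'. (\<forall>x. x \<notin> W \<longrightarrow> c' x = c x) \<and> \<not> symmetric_coloring c'"
proof -
  obtain i j k where no: "\<And>b. \<exists>x. (c(p := i, q := j, r := k)) (b - x) \<noteq> (c(p := i, q := j, r := k)) x"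
    using scalene_extension_without_reflection[OF assms(2), of c] by blast
  let ?c = "c(p := i, q := j, r := k)"
  have "\<not> symmetric_coloring ?c \<or> \<not> symmetric_coloring (?c(p := \<not> ?c p))"
    using reflection_if_recoloring_symmetric[of ?c p] no by blast
  moreover have "\<forall>x. x \<notin> W \<longrightarrow> ?c x = c x" "\<forall>x. x \<notin> W \<longrightarrow> (?c(p := \<not> ?c p)) x = c x"
    using assms(1) by auto
  ultimately show ?thesis by blast
qed

subsection \<open>The circle\<close>

lemma Rep_pt: "Rep_circle (pt x) = frac x"
  by (simp add: pt_def Abs_circle_inverse frac_lt_1)

lemma Rep_circle_bounds: "0 \<le> Rep_circle p" "Rep_circle p < 1"
  using Rep_circle[of p] by auto

lemma pt_Rep: "pt (Rep_circle p) = p"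
  by (metis Rep_circle_bounds Rep_circle_inverse frac_eq pt_def)

lemma pt_eq_iff: "pt x = pt y \<longleftrightarrow> x - y \<in> \<int>"
proof
  assume "pt x = pt y"
  then have "frac x = frac y" by (metis Rep_pt)
  then have "x - y = of_int (\<lfloor>x\<rfloor> - \<lfloor>y\<rfloor>)" by (simp add: frac_def)
  then show "x - y \<in> \<int>" by (metis Ints_of_int)
next
  assume "x - y \<in> \<int>"
  then obtain n where "x = y + of_int n" by (metis Ints_cases add.commute diff_add_cancel)
  then show "pt x = pt y" by (simp add: pt_def frac_def)
qed

lemma frac_diff_Ints: "frac x - x \<in> \<int>"
  by (simp add: frac_def)

section \<open>The circle as the quotient group of the reals by the integers\<close>

instantiation circle :: ab_group_add
begin

definition "0 = pt 0"
definition "p + q = pt (Rep_circle p + Rep_circle q)"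
definition "- p = pt (- Rep_circle p)"
definition "p - q = pt (Rep_circle p - Rep_circle q)" for p q :: circle

lemma pt_plus: "pt x + pt y = pt (x + y)"
proof -
  have "(frac x - x) + (frac y - y) \<in> \<int>" by (intro Ints_add frac_diff_Ints)
  then show ?thesis by (simp add: plus_circle_def Rep_pt pt_eq_iff algebra_simps)
qed

lemma pt_uminus: "- pt x = pt (- x)"
  using Ints_minus[OF frac_diff_Ints[of x]] by (simp add: uminus_circle_def Rep_pt pt_eq_iff)

lemma pt_minus: "pt x - pt y = pt (x - y)"
proof -
  have "(frac x - x) - (frac y - y) \<in> \<int>" by (intro Ints_diff frac_diff_Ints)
  then show ?thesis by (simp add: minus_circle_def Rep_pt pt_eq_iff algebra_simps)
qed

instance
proof
  fix p q r :: circle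
  show "p + q + r = p + (q + r)"
    by (metis pt_Rep pt_plus add.assoc)
  show "p + q = q + p"
    by (simp add: plus_circle_def add.commute)
  show "0 + p = p"
    by (metis pt_Rep pt_plus zero_circle_def add_0)
  show "- p + p = 0"
    by (metis pt_Rep pt_plus pt_uminus zero_circle_def ab_left_minus)
  show "p - q = p + - q"
    by (metis pt_Rep pt_plus pt_uminus pt_minus diff_conv_add_uminus)
qed

end

lemma rot_eq: "rot a p = p + pt a"
  by (metis rot_def pt_Rep pt_plus)

lemma refl_eq: "refl a p = pt (2 * a) - p"
  by (metis refl_def pt_Rep pt_minus uminus_add_conv_diff)

lemma distinguishing_if_not_symmetric:
  assumes "\<not> symmetric_coloring c"
  shows "distinguishing c"
  unfolding distinguishing_def
proof (intro ballI impI notI)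
  fix \<gamma> assume \<gamma>: "\<gamma> \<in> O2" "\<gamma> \<noteq> id" "c \<circ> \<gamma> = c"
  have c: "c (\<gamma> x) = c x" for x using \<gamma>(3) by (metis comp_apply)
  from \<gamma>(1) consider a where "\<gamma> = rot a" | a where "\<gamma> = refl a"
    by (auto simp: O2_def)
  then show False
  proof cases
    case 1
    then have "pt a \<noteq> 0" using \<gamma>(2) by (auto simp: fun_eq_iff rot_eq)
    then show False using assms c 1 by (auto simp: symmetric_coloring_def rot_eq)
  next
    case 2
    then show False using assms c by (auto simp: symmetric_coloring_def refl_eq)
  qed
qed

lemma propP_if_scalene:
  assumes "{p, q, r} \<subseteq> W" "scalene p q r"
  shows "propP W"
  unfolding propP_def
proof
  show "trivial_pointwise_stabilizer W"
    unfolding trivial_pointwise_stabilizer_def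
  proof (intro ballI impI)
    fix \<gamma> assume \<gamma>: "\<gamma> \<in> O2" "\<forall>w\<in>W. \<gamma> w = w"
    have fixed: "\<gamma> p = p" "\<gamma> q = q" "\<gamma> r = r" using \<gamma>(2) assms(1) by auto
    from \<gamma>(1) consider a where "\<gamma> = rot a" | a where "\<gamma> = refl a"
      by (auto simp: O2_def)
    then show "\<gamma> = id"
    proof cases
      case 1
      then show ?thesis using fixed(1) by (auto simp: fun_eq_iff rot_eq)
    next
      case 2
      then have "(\<lambda>x. pt (2 * a) - x) ` {p, q, r} = {p, q, r}"
        using fixed by (simp add: refl_eq)
      then show ?thesis using assms(2) unfolding scalene_def by blast
    qed
  qed
  show "\<forall>c. \<exists>c'. (\<forall>x. x \<notin> W \<longrightarrow> c' x = c x) \<and> distinguishing c'"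
    using scalene_extension_asymmetric[OF assms] distinguishing_if_not_symmetric by blast
qed

section \<open>Five points without a scalene triple\<close>

text \<open>Two of the arcs a, b, 1 - a - b of a triangle are equal.\<close>
definition equal_arcs :: "real \<Rightarrow> real \<Rightarrow> bool" where
  "equal_arcs a b \<longleftrightarrow> a = b \<or> 2 * a + b = 1 \<or> a + 2 * b = 1"

lemma equal_arcs_rotate: "equal_arcs a b \<Longrightarrow> a + b + c = 1 \<Longrightarrow> equal_arcs b c"
  by (auto simp: equal_arcs_def)

lemma Ints_between:
  fixes x :: real
  assumes "x \<in> \<int>" "of_int n - 1 < x" "x < of_int n + 1"
  shows "x = of_int n"
  using assms by (auto elim!: Ints_cases)

lemma equal_arcs_if_not_scalene:
  assumes "0 \<le> x" "x < y" "y < z" "z < 1" "\<not> scalene (pt x) (pt y) (pt z)"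
  shows "equal_arcs (y - x) (z - y)"
proof -
  let ?p = "pt x" and ?q = "pt y" and ?r = "pt z"
  obtain b where b: "b - ?p \<in> {?p, ?q, ?r}" "b - ?q \<in> {?p, ?q, ?r}" "b - ?r \<in> {?p, ?q, ?r}"
    using assms(5) unfolding scalene_def by blast
  have ne: "?p \<noteq> ?q" "?p \<noteq> ?r" "?q \<noteq> ?r"
    using Ints_between[of "x - y" 0] Ints_between[of "x - z" 0] Ints_between[of "y - z" 0] assms
    by (auto simp: pt_eq_iff)
  \<comment> \<open>The reflection fixes one vertex and swaps the others, or fixes all three; the
    last case would make both gaps half the circle.\<close>
  from b consider "?p + ?p = ?q + ?r" | "?q + ?q = ?p + ?r" | "?r + ?r = ?p + ?q"
    | "?p + ?p = ?q + ?q" "?q + ?q = ?r + ?r"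
    using ne by (auto simp: diff_eq_eq add.commute)
  then show ?thesis
  proof cases
    case 1
    then have "x + x - (y + z) = of_int (- 1)"
      using assms by (intro Ints_between) (auto simp: pt_plus pt_eq_iff)
    then show ?thesis by (simp add: equal_arcs_def)
  next
    case 2
    then have "y + y - (x + z) = of_int 0"
      using assms by (intro Ints_between) (auto simp: pt_plus pt_eq_iff)
    then show ?thesis by (simp add: equal_arcs_def)
  next
    case 3
    then have "z + z - (x + y) = of_int 1"
      using assms by (intro Ints_between) (auto simp: pt_plus pt_eq_iff)
    then show ?thesis by (simp add: equal_arcs_def)
  next
    case 4
    have "x + x - (y + y) = of_int (- 1)"
      using 4 assms by (intro Ints_between) (auto simp: pt_plus pt_eq_iff)
    moreover have "y + y - (z + z) = of_int (- 1)"
      using 4 assms by (intro Ints_between) (auto simp: pt_plus pt_eq_iff)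
    ultimately show ?thesis using assms by simp
  qed
qed

text \<open>The hypotheses cover all ten triples of five points. They are invariant under cyclic
  shifts, so renaming gives the equality of the other neighboring gaps.\<close>

lemma equal_arcs_first_two_gaps:
  fixes g1 g2 g3 g4 g5 :: real
  assumes "g1 > 0" "g2 > 0" "g3 > 0" "g4 > 0" "g5 > 0" "g1 + g2 + g3 + g4 + g5 = 1"
    and "equal_arcs g1 g2" "equal_arcs g2 g3" "equal_arcs g3 g4" "equal_arcs g4 g5"
      "equal_arcs g5 g1" "equal_arcs g1 (g2 + g3)" "equal_arcs g2 (g3 + g4)"
      "equal_arcs g3 (g4 + g5)" "equal_arcs g4 (g5 + g1)" "equal_arcs g5 (g1 + g2)"
  shows "g1 = g2"
  using assms unfolding equal_arcs_def by (smt (verit))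

lemma real_set_card_5_sorted:
  fixes A :: "real set"
  assumes "card A = 5"
  obtains a b c d e where "A = {a, b, c, d, e}" "a < b" "b < c" "c < d" "d < e"
proof -
  have A: "finite A" using assms card.infinite by fastforce
  define xs where "xs = sorted_list_of_set A"
  have "length xs = 5" using A assms by (simp add: xs_def)
  then obtain a b c d e where "xs = [a, b, c, d, e]"
    by (auto simp: eval_nat_numeral length_Suc_conv)
  then have xs: "sorted_list_of_set A = [a, b, c, d, e]" by (simp add: xs_def)
  have "sorted_wrt (<) [a, b, c, d, e]" using strict_sorted_list_of_set[of A] by (simp add: xs)
  moreover have "A = {a, b, c, d, e}" using set_sorted_list_of_set[OF A] by (auto simp: xs)
  ultimately show thesis using that by simp
qed

lemma pentagon_if_no_scalene:
  assumes card: "card W = 5"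
    and iso: "\<And>p q r. {p, q, r} \<subseteq> W \<Longrightarrow> \<not> scalene p q r"
  shows "O2_congruent W pentagon"
proof -
  have "card (Rep_circle ` W) = 5"
    using card by (subst card_image) (auto intro: inj_onI simp: Rep_circle_inject)
  then obtain a b c d e where R: "Rep_circle ` W = {a, b, c, d, e}"
    and less: "a < b" "b < c" "c < d" "d < e"
    by (rule real_set_card_5_sorted)
  have "W = pt ` Rep_circle ` W" by (simp add: image_image pt_Rep)
  then have W: "W = {pt a, pt b, pt c, pt d, pt e}" by (simp add: R)
  have bounds: "0 \<le> a" "e < 1" using R Rep_circle_bounds by (metis imageE insertCI)+
  have arcs: "equal_arcs (y - x) (z - y)"
    if "x < y" "y < z" "{x, y, z} \<subseteq> {a, b, c, d, e}" for x y z
    using that less bounds iso[of "pt x" "pt y" "pt z"] W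
    by (intro equal_arcs_if_not_scalene) auto
  define g1 g2 g3 g4 g5 where g: "g1 = b - a" "g2 = c - b" "g3 = d - c" "g4 = e - d" "g5 = 1 - (e - a)"
  have pos: "g1 > 0" "g2 > 0" "g3 > 0" "g4 > 0" "g5 > 0" and total: "g1 + g2 + g3 + g4 + g5 = 1"
    using less bounds by (auto simp: g)
  \<comment> \<open>Triples whose two chosen arcs pass through 0 are obtained by rotating the arcs
    of a sorted triple.\<close>
  have adjacent: "equal_arcs g1 g2" "equal_arcs g2 g3" "equal_arcs g3 g4" "equal_arcs g4 g5"
      "equal_arcs g5 g1"
    using arcs[of a b c] arcs[of b c d] arcs[of c d e]
      equal_arcs_rotate[OF arcs[of a d e], of g5]
      equal_arcs_rotate[OF equal_arcs_rotate[OF arcs[of a b e], of g5], of g1] less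
    by (auto simp: g)
  have far: "equal_arcs g1 (g2 + g3)" "equal_arcs g2 (g3 + g4)" "equal_arcs g3 (g4 + g5)"
      "equal_arcs g4 (g5 + g1)" "equal_arcs g5 (g1 + g2)"
    using arcs[of a b d] arcs[of b c e]
      equal_arcs_rotate[OF arcs[of a c d], of "g4 + g5"]
      equal_arcs_rotate[OF arcs[of b d e], of "g5 + g1"]
      equal_arcs_rotate[OF equal_arcs_rotate[OF arcs[of a c e], of g5], of "g1 + g2"] less
    by (auto simp: g)
  have "g1 = g2" by (rule equal_arcs_first_two_gaps[OF pos total adjacent far])
  moreover have "g2 = g3"
    by (rule equal_arcs_first_two_gaps[of g2 g3 g4 g5 g1]) (use pos total adjacent far in auto)
  moreover have "g3 = g4"
    by (rule equal_arcs_first_two_gaps[of g3 g4 g5 g1 g2]) (use pos total adjacent far in auto)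
  moreover have "g4 = g5"
    by (rule equal_arcs_first_two_gaps[of g4 g5 g1 g2 g3]) (use pos total adjacent far in auto)
  ultimately have "b = a + 1/5" "c = a + 2/5" "d = a + 3/5" "e = a + 4/5"
    by (auto simp: g)
  then have "rot (- a) ` W = pentagon"
    by (simp add: W pentagon_def rot_eq pt_plus)
  then show ?thesis by (auto simp: O2_congruent_def O2_def)
qed

theorem theorem2p4p4:
  fixes W :: "circle set"
  assumes "card W = 5"
    and "\<not> O2_congruent W pentagon"
  shows "propP W"
  using pentagon_if_no_scalene[OF assms(1)] propP_if_scalene assms(2) by blast

end
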